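(* Let $E \subset \mathbb{R}^n$ be compact, let $f: E \to \mathbb{R}$ be a function and let $G: E \rightrightarrows \mathbb{R}^n$ be an upper semicontinuous set-valued mapping such that $G(x)$ is compact, convex and nonempty for every $x\in E$. There exists a convex function $F: \mathbb{R}^n \to \mathbb{R}$ such that $F(x)=f(x)$ and $\partial F(x)= G(x)$ for every $x\in E$ if and only if the following two conditions are both satisfied. $(C)$: $f(x) \geq f(y)+ \langle y^*,x-y \rangle$ for every $x,y\in E$ and every $y^*\in G(y)$. $(PCS)$: For all $x\in E$, $y \in E$ and $y^* \in G(y)$, $$f(x)=f(y)+\langle y^*, x-y \rangle \implies y^* \in G(x).$$
   Context: $\langle\cdot,\cdot\rangle$ is the Euclidean inner product on $\mathbb{R}^n$. A set-valued mapping $G: Y \rightrightarrows Z$ between topological spaces assigns to each $y\in Y$ a subset $G(y)\subset Z$; it is upper semicontinuous on $Y$ if for every $y\in Y$ and every open set $W\subset Z$ containing $G(y)$ there exists a neighbourhood $V$ of $y$ in $Y$ such that $G(V)=\bigcup_{v\in V}G(v)\subset W$. Here $E$ carries the topology induced from $\mathbb{R}^n$. For a convex function $F:\mathbb{R}^n\to\mathbb{R}$, the subdifferential at $x$ is $\partial F(x)=\{\xi\in\mathbb{R}^n : F(z)\ge F(x)+\langle \xi, z-x\rangle \text{ for all } z\in\mathbb{R}^n\}$. *)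

theory Defs
  imports "HOL-Analysis.Analysis"
begin

(* Neighbourhoods of y are taken open; since the condition on V passes to subsets of V,
   this agrees with the version using arbitrary neighbourhoods. *)
definition upper_semicontinuous_mapping ::
  "'a topology \<Rightarrow> 'b topology \<Rightarrow> ('a \<Rightarrow> 'b set) \<Rightarrow> bool" where
  "upper_semicontinuous_mapping Y Z G \<longleftrightarrow>
     (\<forall>y \<in> topspace Y. G y \<subseteq> topspace Z) \<and>
     (\<forall>y \<in> topspace Y. \<forall>W. openin Z W \<and> G y \<subseteq> W \<longrightarrow>
        (\<exists>V. openin Y V \<and> y \<in> V \<and> (\<Union>v\<in>V. G v) \<subseteq> W))"

definition subdifferential :: "('a::real_inner \<Rightarrow> real) \<Rightarrow> 'a \<Rightarrow> 'a set" where
  "subdifferential F x = {\<xi>. \<forall>z. F z \<ge> F x + \<xi> \<bullet> (z - x)}"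

definition condition_C ::
  "'a::real_inner set \<Rightarrow> ('a \<Rightarrow> real) \<Rightarrow> ('a \<Rightarrow> 'a set) \<Rightarrow> bool" where
  "condition_C E f G \<longleftrightarrow>
     (\<forall>x\<in>E. \<forall>y\<in>E. \<forall>y'\<in>G y. f x \<ge> f y + y' \<bullet> (x - y))"

definition condition_PCS ::
  "'a::real_inner set \<Rightarrow> ('a \<Rightarrow> real) \<Rightarrow> ('a \<Rightarrow> 'a set) \<Rightarrow> bool" where
  "condition_PCS E f G \<longleftrightarrow>
     (\<forall>x\<in>E. \<forall>y\<in>E. \<forall>y'\<in>G y. f x = f y + y' \<bullet> (x - y) \<longrightarrow> y' \<in> G x)"

end

(* Condition (C) says that f is the restriction to E of F z = max {f y + y' . (z - y)}, the
   maximum ranging over the graph of G. This graph is compact and f is Lipschitz on E, so the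
   maximum is attained and F is convex with G x contained in its subdifferential at x.
   If xi is a subgradient of F at x outside G x, separate xi from G x by a direction v and let
   (y, y') be a limit of maximizers at the points x + t v as t decreases to 0: then (y, y') is
   a maximizer at x, so that y' lies in G x by (PCS), while y' . v >= xi . v. *)

theory Submission
  imports Defs
begin

text \<open>If the base points of a sequence in the graph tend to \<open>y\<close> along a
  subsequence, upper semicontinuity forces the distance of their values to \<open>G y\<close> to
  tend to 0. Nearest points in the compact set \<open>G y\<close> then have a convergent
  subsequence, and the values converge to the same limit.\<close>

lemma compact_graph_upper_semicontinuous_mapping:
  fixes E :: "'a::metric_space set" and G :: "'a \<Rightarrow> 'b::metric_space set"
  assumes E: "compact E"
    and usc: "upper_semicontinuous_mapping (top_of_set E) euclidean G"
    and G: "\<And>x. x \<in> E \<Longrightarrow> compact (G x)" "\<And>x. x \<in> E \<Longrightarrow> G x \<noteq> {}"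
  shows "compact (SIGMA x:E. G x)"
  unfolding compact_def
proof (intro allI impI)
  fix p :: "nat \<Rightarrow> 'a \<times> 'b"
  assume p: "\<forall>n. p n \<in> (SIGMA x:E. G x)"
  have p_fst: "fst (p n) \<in> E" and p_snd: "snd (p n) \<in> G (fst (p n))" for n
    using p[rule_format, of n] by auto
  obtain y r where y: "y \<in> E" and r: "strict_mono r" and lim_y: "(fst \<circ> p \<circ> r) \<longlonglongrightarrow> y"
    using E[unfolded compact_def, rule_format, of "fst \<circ> p"] p_fst by auto
  define z where "z n = snd (p (r n))" for n
  \<comment> \<open>A nearest point of \<open>G y\<close> to \<open>z n\<close>; it exists because
    \<open>G y\<close> is compact and nonempty.\<close>
  have "\<exists>g\<in>G y. dist (z n) g = infdist (z n) (G y)" for n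
  proof -
    have "continuous_on (G y) (dist (z n))"
      by (intro continuous_intros)
    then obtain g where "g \<in> G y" "\<forall>h\<in>G y. dist (z n) g \<le> dist (z n) h"
      using continuous_attains_inf[OF G[OF y]] by blast
    moreover from this have "dist (z n) g \<le> infdist (z n) (G y)"
      unfolding infdist_notempty[OF G(2)[OF y]] by (intro cINF_greatest G(2)[OF y]) blast
    ultimately have "dist (z n) g = infdist (z n) (G y)"
      by (simp add: antisym infdist_le)
    with \<open>g \<in> G y\<close> show ?thesis by blast
  qed
  then obtain g where g: "\<And>n. g n \<in> G y" "\<And>n. dist (z n) (g n) = infdist (z n) (G y)"
    by metis
  have "(\<lambda>n. dist (z n) (g n)) \<longlonglongrightarrow> 0"
  proof (rule tendstoI)
    fix e :: real assume "e > 0"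
    \<comment> \<open>The open \<open>e\<close>-neighbourhood of \<open>G y\<close>, to which upper
      semicontinuity at \<open>y\<close> is applied.\<close>
    define W where "W = {w. infdist w (G y) < e}"
    have "open W"
      unfolding W_def by (intro open_Collect_less continuous_intros)
    moreover have "G y \<subseteq> W"
      using \<open>e > 0\<close> by (auto simp: W_def)
    ultimately obtain V where V: "openin (top_of_set E) V" "y \<in> V" "(\<Union>v\<in>V. G v) \<subseteq> W"
      using usc y unfolding upper_semicontinuous_mapping_def
      by (metis open_openin topspace_euclidean_subtopology)
    then obtain T where T: "open T" "V = E \<inter> T"
      by (auto simp: openin_open)
    have "\<forall>\<^sub>F n in sequentially. (fst \<circ> p \<circ> r) n \<in> T"
      using topological_tendstoD[OF lim_y] T V(2) by blast
    then show "\<forall>\<^sub>F n in sequentially. dist (dist (z n) (g n)) 0 < e"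
    proof eventually_elim
      case (elim n)
      then have "z n \<in> W"
        using V(3) T p_fst p_snd by (force simp: z_def)
      then show ?case
        by (simp add: g W_def infdist_nonneg)
    qed
  qed
  moreover obtain h s where h: "h \<in> G y" and s: "strict_mono s" and lim_g: "(g \<circ> s) \<longlonglongrightarrow> h"
    using G(1)[OF y, unfolded compact_def, rule_format, of g] g(1) by blast
  ultimately have "(\<lambda>n. dist (z (s n)) (g (s n))) \<longlonglongrightarrow> 0"
    using LIMSEQ_subseq_LIMSEQ[OF _ s] by (simp add: o_def)
  moreover have "(\<lambda>n. dist (g (s n)) h) \<longlonglongrightarrow> 0"
    using lim_g by (simp add: o_def flip: tendsto_dist_iff)
  ultimately have "(\<lambda>n. dist (z (s n)) (g (s n)) + dist (g (s n)) h) \<longlonglongrightarrow> 0"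
    by (rule tendsto_add_zero)
  then have "(\<lambda>n. dist (z (s n)) h) \<longlonglongrightarrow> 0"
    by (rule Lim_null_comparison[rotated]) (simp add: dist_triangle)
  then have "(\<lambda>n. z (s n)) \<longlonglongrightarrow> h"
    by (simp flip: tendsto_dist_iff)
  moreover have "(\<lambda>n. fst (p (r (s n)))) \<longlonglongrightarrow> y"
    using LIMSEQ_subseq_LIMSEQ[OF lim_y s] by (simp add: o_def)
  ultimately have "(p \<circ> (r \<circ> s)) \<longlonglongrightarrow> (y, h)"
    using tendsto_Pair by (force simp: o_def z_def)
  then show "\<exists>l\<in>SIGMA x:E. G x. \<exists>r. strict_mono r \<and> (p \<circ> r) \<longlonglongrightarrow> l"
    using y h strict_mono_o[OF r s] by blast
qed

text \<open>Condition (C) based at \<open>y\<close> bounds \<open>f y - f x\<close> by the norm of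
  any element of \<open>G y\<close> times the distance. Exchanging \<open>x\<close> and
  \<open>y\<close> shows that a common bound of all these norms is a Lipschitz constant.\<close>

lemma condition_C_imp_continuous_on:
  fixes E :: "'a::real_inner set"
  assumes C: "condition_C E f G" and bdd: "bounded (\<Union>x\<in>E. G x)"
    and G: "\<And>x. x \<in> E \<Longrightarrow> G x \<noteq> {}"
  shows "continuous_on E f"
proof -
  obtain B where B: "B > 0" "\<And>x g. x \<in> E \<Longrightarrow> g \<in> G x \<Longrightarrow> norm g \<le> B"
    using bdd by (auto simp: bounded_pos)
  have le: "f y - f x \<le> B * dist x y" if xy: "x \<in> E" "y \<in> E" for x y
  proof -
    obtain g where g: "g \<in> G y"
      using G xy by blast
    have "f y - f x \<le> g \<bullet> (y - x)"
      using C xy g by (force simp: condition_C_def inner_diff_right)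
    also have "\<dots> \<le> norm g * norm (y - x)"
      by (rule norm_cauchy_schwarz)
    also have "\<dots> \<le> B * dist x y"
      using B(2)[OF xy(2) g] by (auto simp: dist_norm norm_minus_commute intro: mult_right_mono)
    finally show ?thesis .
  qed
  have "B-lipschitz_on E f"
  proof (rule lipschitz_onI)
    fix x y assume "x \<in> E" "y \<in> E"
    with le[of x y] le[of y x] show "dist (f x) (f y) \<le> B * dist x y"
      by (simp add: dist_real_def dist_commute abs_le_iff)
  qed (use B in simp)
  then show ?thesis
    by (rule lipschitz_on_continuous_on)
qed

text \<open>(C) is the subgradient inequality between points of \<open>E\<close>. For (PCS), the
  affine minorant of \<open>F\<close> with slope \<open>y'\<close> that touches \<open>F\<close> at
  \<open>y\<close> also touches it at \<open>x\<close>, so it supports \<open>F\<close> there as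
  well.\<close>

lemma subdifferential_extension_imp_conditions:
  fixes E :: "'a::real_inner set"
  assumes F: "\<And>x. x \<in> E \<Longrightarrow> F x = f x" "\<And>x. x \<in> E \<Longrightarrow> subdifferential F x = G x"
  shows "condition_C E f G \<and> condition_PCS E f G"
proof
  show "condition_C E f G"
    unfolding condition_C_def
  proof (intro ballI)
    fix x y y' assume "x \<in> E" "y \<in> E" "y' \<in> G y"
    then have "y' \<in> subdifferential F y"
      by (simp add: F)
    then have "F x \<ge> F y + y' \<bullet> (x - y)"
      by (simp add: subdifferential_def)
    then show "f x \<ge> f y + y' \<bullet> (x - y)"
      using F(1) \<open>x \<in> E\<close> \<open>y \<in> E\<close> by simp
  qed
  show "condition_PCS E f G"
    unfolding condition_PCS_def
  proof (intro ballI impI)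
    fix x y y' assume xy: "x \<in> E" "y \<in> E" "y' \<in> G y" and eq: "f x = f y + y' \<bullet> (x - y)"
    have "F z \<ge> F x + y' \<bullet> (z - x)" for z
    proof -
      have "F z \<ge> F y + y' \<bullet> (z - y)"
        using xy F(2)[of y] by (auto simp: subdifferential_def)
      then show ?thesis
        using eq xy F(1) by (simp add: inner_diff_right)
    qed
    then show "y' \<in> G x"
      using F(2)[OF xy(1)] by (auto simp: subdifferential_def)
  qed
qed

lemma convex_extension_of_conditions:
  fixes E :: "'a::euclidean_space set"
  assumes E: "compact E"
    and usc: "upper_semicontinuous_mapping (top_of_set E) euclidean G"
    and G: "\<And>x. x \<in> E \<Longrightarrow> compact (G x) \<and> convex (G x) \<and> G x \<noteq> {}"
    and C: "condition_C E f G" and PCS: "condition_PCS E f G"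
  shows "\<exists>F. convex_on UNIV F \<and> (\<forall>x\<in>E. F x = f x \<and> subdifferential F x = G x)"
proof (cases "E = {}")
  case True
  \<comment> \<open>With an empty graph there is no maximum to take, but any convex function will
    do.\<close>
  have "convex_on UNIV (\<lambda>_::'a. 0::real)"
    by (simp add: convex_on_def)
  with True show ?thesis
    by blast
next
  case False
  define K where "K = (SIGMA x:E. G x)"
  \<comment> \<open>For a fixed \<open>p\<close> in the graph, an affine function of
    \<open>z\<close>: slope \<open>snd p\<close>, value \<open>f (fst p)\<close> at
    \<open>fst p\<close>.\<close>
  define \<phi> where "\<phi> z p = f (fst p) + snd p \<bullet> (z - fst p)" for z p
  have K: "compact K"
    unfolding K_def using compact_graph_upper_semicontinuous_mapping[OF E usc] G by blast
  have "K \<noteq> {}"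
    using False G by (auto simp: K_def)
  have "(\<Union>x\<in>E. G x) = snd ` K"
    by (force simp: K_def)
  then have "bounded (\<Union>x\<in>E. G x)"
    using K by (metis bounded_snd compact_imp_bounded)
  then have "continuous_on E f"
    using condition_C_imp_continuous_on C G by blast
  moreover have "fst ` K \<subseteq> E"
    by (auto simp: K_def)
  ultimately have "continuous_on K (\<lambda>p. f (fst p))"
    using continuous_on_compose2 continuous_on_fst[OF continuous_on_id] by blast
  then have \<phi>_cont: "continuous_on K (\<phi> z)" for z
    unfolding \<phi>_def by (intro continuous_intros)
  have "\<exists>p\<in>K. \<forall>q\<in>K. \<phi> z q \<le> \<phi> z p" for z
    using continuous_attains_sup[OF K \<open>K \<noteq> {}\<close> \<phi>_cont] by blast
  then obtain P where P: "\<And>z. P z \<in> K" and P_max: "\<And>z p. p \<in> K \<Longrightarrow> \<phi> z p \<le> \<phi> z (P z)"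
    by metis
  define F where "F z = \<phi> z (P z)" for z
  have "convex_on UNIV F"
  proof (rule convex_onI)
    fix t :: real and x y :: 'a assume t: "0 < t" "t < 1"
    \<comment> \<open>One maximizer, the one at the convex combination, serves all three points: its
      function is affine in \<open>z\<close> and lies below \<open>F\<close> at \<open>x\<close> and
      \<open>y\<close>.\<close>
    define q where "q = P ((1 - t) *\<^sub>R x + t *\<^sub>R y)"
    have "F ((1 - t) *\<^sub>R x + t *\<^sub>R y) = (1 - t) * \<phi> x q + t * \<phi> y q"
      by (simp add: F_def \<phi>_def q_def algebra_simps inner_add_right inner_diff_right)
    also have "\<dots> \<le> (1 - t) * F x + t * F y"
      using t P P_max unfolding F_def q_def by (intro add_mono mult_left_mono) auto
    finally show "F ((1 - t) *\<^sub>R x + t *\<^sub>R y) \<le> (1 - t) * F x + t * F y" .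
  qed simp
  moreover have F_eq: "F x = f x" if x: "x \<in> E" for x
  proof (rule antisym)
    \<comment> \<open>By (C) every affine function in the family lies below \<open>f\<close> on
      \<open>E\<close>; below, one based at \<open>x\<close> itself attains
      \<open>f x\<close>.\<close>
    show "F x \<le> f x"
      using P[of x] C x by (force simp: F_def \<phi>_def K_def condition_C_def)
    obtain g where "g \<in> G x"
      using G x by blast
    then show "f x \<le> F x"
      using P_max[of "(x, g)" x] x by (simp add: F_def \<phi>_def K_def)
  qed
  moreover have "subdifferential F x = G x" if x: "x \<in> E" for x
  proof
    \<comment> \<open>For \<open>g\<close> in \<open>G x\<close> the pair \<open>(x, g)\<close>
      competes in the maximum, and its affine function takes the value \<open>F x\<close> at
      \<open>x\<close>.\<close>
    show "G x \<subseteq> subdifferential F x"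
      using P_max[of "(x, _)"] x F_eq[OF x]
      by (force simp: subdifferential_def F_def \<phi>_def K_def)
    show "subdifferential F x \<subseteq> G x"
    proof (rule subsetI, rule ccontr)
      fix \<xi> assume \<xi>: "\<xi> \<in> subdifferential F x" and "\<xi> \<notin> G x"
      then obtain v b where v: "\<xi> \<bullet> v > b" "\<And>g. g \<in> G x \<Longrightarrow> g \<bullet> v < b"
      proof -
        obtain a b where "a \<bullet> \<xi> < b" "\<And>g. g \<in> G x \<Longrightarrow> a \<bullet> g > b"
          using separating_hyperplane_closed_point[of "G x" \<xi>] G[OF x] \<open>\<xi> \<notin> G x\<close>
          by (auto simp: compact_imp_closed)
        then show thesis
          \<comment> \<open>The separating hyperplane is negated so that \<xi> lies on its upper
            side; moving from \<open>x\<close> along \<open>v\<close> then tests the slopes in the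
            direction favouring \<xi>.\<close>
          by (intro that[of "- b" "- a"]) (auto simp: inner_commute)
      qed
      define t where "t n = inverse (real (Suc n))" for n
      have t: "t n > 0" for n
        by (simp add: t_def)
      define p where "p n = P (x + t n *\<^sub>R v)" for n
      have p: "p n \<in> K" for n
        by (simp add: p_def P)
      have \<phi>_add: "\<phi> (x + s *\<^sub>R v) q = \<phi> x q + s * (snd q \<bullet> v)" for s q
        by (simp add: \<phi>_def algebra_simps inner_add_right inner_diff_right)
      \<comment> \<open>The subgradient inequality at \<open>x + t n *\<^sub>R v\<close>, with
        \<open>F\<close> there written through its maximizer \<open>p n\<close>.\<close>
      have ge: "f x + t n * (\<xi> \<bullet> v) \<le> \<phi> x (p n) + t n * (snd (p n) \<bullet> v)" for n
      proof -
        have "F (x + t n *\<^sub>R v) \<ge> F x + \<xi> \<bullet> (x + t n *\<^sub>R v - x)"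
          using \<xi> unfolding subdifferential_def by blast
        then show ?thesis
          using F_eq[OF x] \<phi>_add by (simp add: F_def p_def)
      qed
      have p_v: "\<xi> \<bullet> v \<le> snd (p n) \<bullet> v" for n
      proof -
        \<comment> \<open>Being optimal at the shifted point, \<open>p n\<close> need not be optimal
          at \<open>x\<close>; this one-sided bound suffices to cancel \<open>f x\<close> and divide
          by \<open>t n > 0\<close>.\<close>
        have "\<phi> x (p n) \<le> f x"
          using P_max[OF p[of n], of x] F_eq[OF x] by (simp add: F_def)
        with ge[of n] have "t n * (\<xi> \<bullet> v) \<le> t n * (snd (p n) \<bullet> v)"
          by linarith
        then show ?thesis
          using t by simp
      qed
      obtain q r where q: "q \<in> K" and r: "strict_mono r" and lim_q: "(p \<circ> r) \<longlonglongrightarrow> q"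
        using K p unfolding compact_def by metis
      have lim_v: "(\<lambda>n. snd (p (r n)) \<bullet> v) \<longlonglongrightarrow> snd q \<bullet> v"
        using lim_q by (auto simp: o_def intro!: tendsto_intros)
      have lim_\<phi>: "(\<lambda>n. \<phi> x (p (r n))) \<longlonglongrightarrow> \<phi> x q"
        using continuous_on_tendsto_compose[OF \<phi>_cont lim_q q] p by (simp add: o_def)
      have lim_t: "(\<lambda>n. t (r n)) \<longlonglongrightarrow> 0"
        using LIMSEQ_subseq_LIMSEQ[OF LIMSEQ_inverse_real_of_nat r] by (simp add: t_def o_def)
      have "(\<lambda>n. f x + t (r n) * (\<xi> \<bullet> v)) \<longlonglongrightarrow> f x + 0 * (\<xi> \<bullet> v)"
        by (intro tendsto_intros lim_t)
      moreover have "(\<lambda>n. \<phi> x (p (r n)) + t (r n) * (snd (p (r n)) \<bullet> v))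
          \<longlonglongrightarrow> \<phi> x q + 0 * (snd q \<bullet> v)"
        by (intro tendsto_intros lim_t lim_v lim_\<phi>)
      \<comment> \<open>In the limit the terms with \<open>t\<close> vanish, so \<open>q\<close> is
        a maximizer at \<open>x\<close>: this gives the equality that (PCS) requires.\<close>
      ultimately have "f x + 0 * (\<xi> \<bullet> v) \<le> \<phi> x q + 0 * (snd q \<bullet> v)"
        by (rule LIMSEQ_le) (use ge in blast)
      moreover have "\<phi> x q \<le> f x"
        using P_max[OF q, of x] F_eq[OF x] by (simp add: F_def)
      ultimately have "f x = f (fst q) + snd q \<bullet> (x - fst q)"
        by (simp add: \<phi>_def)
      moreover have "fst q \<in> E" "snd q \<in> G (fst q)"
        using q by (auto simp: K_def)
      ultimately have "snd q \<in> G x"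
        using PCS x unfolding condition_PCS_def by blast
      moreover have "\<xi> \<bullet> v \<le> snd q \<bullet> v"
        using lim_v p_v by (intro LIMSEQ_le_const) auto
      \<comment> \<open>The limit slope lies in \<open>G x\<close>, hence
        \<open>snd q \<bullet> v < b < \<xi> \<bullet> v\<close>, against the inequality just
        obtained.\<close>
      ultimately show False
        using v by fastforce
    qed
  qed
  ultimately show ?thesis
    by blast
qed

theorem theorem1p2:
  fixes E :: "(real ^ 'n) set"
    and f :: "real ^ 'n \<Rightarrow> real"
    and G :: "real ^ 'n \<Rightarrow> (real ^ 'n) set"
  assumes "compact E"
    and "upper_semicontinuous_mapping (top_of_set E) euclidean G"
    and "\<And>x. x \<in> E \<Longrightarrow> compact (G x) \<and> convex (G x) \<and> G x \<noteq> {}"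
  shows "(\<exists>F :: real ^ 'n \<Rightarrow> real. convex_on UNIV F \<and>
            (\<forall>x\<in>E. F x = f x \<and> subdifferential F x = G x))
         \<longleftrightarrow> condition_C E f G \<and> condition_PCS E f G"
proof
  assume "\<exists>F :: real ^ 'n \<Rightarrow> real. convex_on UNIV F \<and>
            (\<forall>x\<in>E. F x = f x \<and> subdifferential F x = G x)"
  then obtain F where "\<And>x. x \<in> E \<Longrightarrow> F x = f x" "\<And>x. x \<in> E \<Longrightarrow> subdifferential F x = G x"
    by blast
  then show "condition_C E f G \<and> condition_PCS E f G"
    by (rule subdifferential_extension_imp_conditions)
next
  assume "condition_C E f G \<and> condition_PCS E f G"
  then show "\<exists>F :: real ^ 'n \<Rightarrow> real. convex_on UNIV F \<and>
            (\<forall>x\<in>E. F x = f x \<and> subdifferential F x = G x)"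
    using convex_extension_of_conditions[OF assms] by simp
qed

end
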